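(* Let $A\in\mathbb{R}_+^{n\times n}$ be irreducible and definite, and let $\gamma$ be the cyclicity of $\mathcal{C}(A)$. All powers $A^r$ for $r\ge T(A)$ have the same (max-algebraic) column span, which is the eigencone $V(A^\gamma)$.
   Context: Max algebra: on $\mathbb{R}_+=[0,\infty)$ put $a\oplus b=\max(a,b)$, $a\otimes b=ab$, extended to matrices and vectors by $(A\oplus B)_{ij}=\max(a_{ij},b_{ij})$, $(A\otimes B)_{ij}=\max_k a_{ik}b_{kj}$; $A^k$ is the $k$-th max-algebraic power, $A^0=I$. The column span of $A$ is $\{\bigoplus_{i=1}^n\alpha_iA_{\cdot i}:\alpha_i\in\mathbb{R}_+\}$. The digraph $\mathcal{D}(A)$ has nodes $1,\dots,n$ and an edge $(i,j)$ of weight $a_{ij}$ iff $a_{ij}\neq 0$; the weight of a path is the product of its edge weights, and the geometric mean of a cycle with $k$ edges is its weight to the power $1/k$. $\lambda(A)$ is the maximum cycle geometric mean. $A$ is definite if $\lambda(A)=1$, and irreducible if for all nodes $i,j$ there is a path in $\mathcal{D}(A)$ from $i$ to $j$. A cycle is critical if its geometric mean equals $\lambda(A)$; the critical graph $\mathcal{C}(A)$ consists of all nodes (the set $N_c(A)$) and edges belonging to critical cycles. The cyclicity of a strongly connected digraph is the gcd of the lengths of its cycles; the cyclicity $\gamma$ of $\mathcal{C}(A)$ is the lcm of the cyclicities of its strongly connected components. $V(B)=\{x\in\mathbb{R}_+^n: B\otimes x=\lambda(B)x\}$ is the eigencone of $B$ associated with $\lambda(B)$ (zero vector included); here $\lambda(A^\gamma)=1$.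 For a definite $B$, $B^*=I\oplus B\oplus\dots\oplus B^{n-1}$ and $Q(B)$ has entries $q_{ij}=\bigoplus_{k\in N_c(B)}b^*_{ik}b^*_{kj}$. The transient $T(A)$ of an irreducible definite $A$ is an integer such that $A^{t\gamma}=Q(A^\gamma)$ whenever $t\gamma\ge T(A)$, and $A^{r+\gamma}=A^r$ for all $r\ge T(A)$ (such an integer exists). *)

theory Defs
  imports "HOL-Analysis.Analysis" "Graph_Theory.Digraph_Component"
begin

text \<open>
  Max algebra over the nonnegative reals.  Matrices and vectors over that semiring are real ones
  whose entries are required to be nonnegative (\<open>nonneg_mat\<close>, \<open>nonneg_vec\<close>).
\<close>

definition nonneg_vec :: "real ^ 'n \<Rightarrow> bool" where
  "nonneg_vec x \<longleftrightarrow> (\<forall>i. 0 \<le> x $ i)"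

definition nonneg_mat :: "real ^ 'n ^ 'm \<Rightarrow> bool" where
  "nonneg_mat A \<longleftrightarrow> (\<forall>i j. 0 \<le> A $ i $ j)"

text \<open>
  The finite max-algebraic sum.  The inserted 0 is the neutral element of the maximum on the
  nonnegative reals; it only matters for an empty index set.
\<close>

definition max_sum :: "('i \<Rightarrow> real) \<Rightarrow> 'i set \<Rightarrow> real" where
  "max_sum f S = Max (insert 0 (f ` S))"

definition max_mult :: "real ^ 'k ^ 'm \<Rightarrow> real ^ 'n ^ 'k \<Rightarrow> real ^ 'n ^ 'm" where
  "max_mult A B = (\<chi> i j. max_sum (\<lambda>k. A $ i $ k * B $ k $ j) UNIV)"

definition max_mult_vec :: "real ^ 'n ^ 'm \<Rightarrow> real ^ 'n \<Rightarrow> real ^ 'm" where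
  "max_mult_vec A x = (\<chi> i. max_sum (\<lambda>k. A $ i $ k * x $ k) UNIV)"

primrec max_power :: "real ^ 'n ^ 'n \<Rightarrow> nat \<Rightarrow> real ^ 'n ^ 'n" where
  "max_power A 0 = mat 1"
| "max_power A (Suc k) = max_mult A (max_power A k)"

definition column_span :: "real ^ 'n ^ 'm \<Rightarrow> (real ^ 'm) set" where
  "column_span A =
    {(\<chi> j. max_sum (\<lambda>i. \<alpha> $ i * column i A $ j) UNIV) | \<alpha>. nonneg_vec \<alpha>}"

definition matrix_digraph :: "real ^ 'n ^ 'n \<Rightarrow> ('n, 'n \<times> 'n) pre_digraph" where
  "matrix_digraph A =
    \<lparr>verts = UNIV, arcs = {(i, j). A $ i $ j \<noteq> 0}, tail = fst, head = snd\<rparr>"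

definition irreducible_mat :: "real ^ 'n ^ 'n \<Rightarrow> bool" where
  "irreducible_mat A \<longleftrightarrow> (\<forall>i j. i \<rightarrow>\<^sup>*\<^bsub>matrix_digraph A\<^esub> j)"

text \<open>
  Walks are lists of arcs.  A \<open>cycle\<close> repeats no node except for its coinciding end nodes, and
  may be a loop, so a finite digraph has finitely many cycles.
\<close>

definition walk_weight :: "real ^ 'n ^ 'n \<Rightarrow> ('n \<times> 'n) list \<Rightarrow> real" where
  "walk_weight A p = (\<Prod>(i, j) \<leftarrow> p. A $ i $ j)"

definition geometric_mean :: "real ^ 'n ^ 'n \<Rightarrow> ('n \<times> 'n) list \<Rightarrow> real" where
  "geometric_mean A p = walk_weight A p powr (1 / real (length p))"

text \<open>The maximum cycle geometric mean, which is 0 if there are no cycles.\<close>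

definition max_cycle_mean :: "real ^ 'n ^ 'n \<Rightarrow> real" where
  "max_cycle_mean A = max_sum (geometric_mean A) {p. pre_digraph.cycle (matrix_digraph A) p}"

definition definite_mat :: "real ^ 'n ^ 'n \<Rightarrow> bool" where
  "definite_mat A \<longleftrightarrow> max_cycle_mean A = 1"

definition critical_cycle :: "real ^ 'n ^ 'n \<Rightarrow> ('n \<times> 'n) list \<Rightarrow> bool" where
  "critical_cycle A p \<longleftrightarrow>
    pre_digraph.cycle (matrix_digraph A) p \<and> geometric_mean A p = max_cycle_mean A"

definition critical_graph :: "real ^ 'n ^ 'n \<Rightarrow> ('n, 'n \<times> 'n) pre_digraph" where
  "critical_graph A =
    \<lparr>verts = {v. \<exists>p e. critical_cycle A p \<and> e \<in> set p \<and> (v = fst e \<or> v = snd e)},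
     arcs = {e. \<exists>p. critical_cycle A p \<and> e \<in> set p},
     tail = fst, head = snd\<rparr>"

definition component_cyclicity :: "('a, 'b) pre_digraph \<Rightarrow> nat" where
  "component_cyclicity G = Gcd (length ` {p. pre_digraph.cycle G p})"

definition cyclicity :: "('a, 'b) pre_digraph \<Rightarrow> nat" where
  "cyclicity G = Lcm (component_cyclicity ` pre_digraph.sccs G)"

definition eigencone :: "real ^ 'n ^ 'n \<Rightarrow> (real ^ 'n) set" where
  "eigencone B = {x. nonneg_vec x \<and> max_mult_vec B x = max_cycle_mean B *\<^sub>R x}"

definition max_star :: "real ^ 'n ^ 'n \<Rightarrow> real ^ 'n ^ 'n" where
  "max_star B = (\<chi> i j. max_sum (\<lambda>k. max_power B k $ i $ j) {..<CARD('n)})"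

definition Q_mat :: "real ^ 'n ^ 'n \<Rightarrow> real ^ 'n ^ 'n" where
  "Q_mat B =
    (\<chi> i j. max_sum (\<lambda>k. max_star B $ i $ k * max_star B $ k $ j) (verts (critical_graph B)))"

text \<open>
  The defining property of the transient does not determine it uniquely, so it is a predicate.
\<close>

definition is_transient :: "real ^ 'n ^ 'n \<Rightarrow> int \<Rightarrow> bool" where
  "is_transient A T \<longleftrightarrow>
    (let \<gamma> = cyclicity (critical_graph A) in
      (\<forall>t::nat. T \<le> int (t * \<gamma>) \<longrightarrow> max_power A (t * \<gamma>) = Q_mat (max_power A \<gamma>)) \<and>
      (\<forall>r::nat. T \<le> int r \<longrightarrow> max_power A (r + \<gamma>) = max_power A r))"

end

(* With B = A^gamma, periodicity says that B fixes every column of A^r for r >= T, so the column span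
   of A^r lies in the set of fixed vectors of B. Conversely, a vector x fixed by B satisfies
   x = B^r x = A^r (A^(r gamma - r) x). It remains to see that gamma > 0 and that lambda(B) = 1.
   The first holds because every strong component of the critical graph contains a cycle. For the
   second, a cycle of B heavier than 1 would contradict the stabilisation of the powers of B, and
   following maximising arcs from the support of a nonzero fixed vector gives a cycle of weight 1. *)
theory Submission
  imports Defs
begin

section \<open>Finite max-algebraic sums\<close>

lemma max_sum_le_iff:
  assumes "finite S"
  shows "max_sum f S \<le> c \<longleftrightarrow> 0 \<le> c \<and> (\<forall>k\<in>S. f k \<le> c)"
  using assms by (simp add: max_sum_def)

lemma max_sum_upper: "finite S \<Longrightarrow> k \<in> S \<Longrightarrow> f k \<le> max_sum f S"
  by (simp add: max_sum_def)

lemma max_sum_nonneg: "finite S \<Longrightarrow> 0 \<le> max_sum f S"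
  by (simp add: max_sum_def)

lemma max_sum_in:
  assumes "finite S" "max_sum f S \<noteq> 0"
  obtains k where "k \<in> S" "max_sum f S = f k"
proof -
  have "max_sum f S \<in> insert 0 (f ` S)"
    unfolding max_sum_def using assms(1) by (intro Max_in) auto
  then show thesis using assms(2) that by auto
qed

text \<open>Multiplication by a nonnegative constant is monotone and fixes the inserted 0, so it
  commutes with the maximum.\<close>

lemma max_sum_mult_left:
  assumes "finite S" "0 \<le> c"
  shows "c * max_sum f S = max_sum (\<lambda>k. c * f k) S"
proof -
  have "c * Max (insert 0 (f ` S)) = Max ((*) c ` insert 0 (f ` S))"
    using assms by (intro mono_Max_commute) (auto simp: mono_def mult_left_mono)
  then show ?thesis by (simp add: max_sum_def image_image)
qed

lemma max_sum_swap:
  assumes "finite S" "finite T"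
  shows "max_sum (\<lambda>i. max_sum (f i) T) S = max_sum (\<lambda>j. max_sum (\<lambda>i. f i j) S) T"
proof -
  \<comment> \<open>Stated for fresh index types, so that it can also be used with the two index
    sets exchanged.\<close>
  have le: "max_sum (\<lambda>i. max_sum (f i) T) S \<le> max_sum (\<lambda>j. max_sum (\<lambda>i. f i j) S) T"
    if fin: "finite S" "finite T" for S :: "'c set" and T :: "'d set" and f
  proof -
    have "f i j \<le> max_sum (\<lambda>j. max_sum (\<lambda>i. f i j) S) T" if "i \<in> S" "j \<in> T" for i j
      using max_sum_upper[OF fin(1) that(1), of "\<lambda>i. f i j"]
        max_sum_upper[OF fin(2) that(2), of "\<lambda>j. max_sum (\<lambda>i. f i j) S"] by linarith
    then show ?thesis using fin by (simp add: max_sum_le_iff max_sum_nonneg)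
  qed
  show ?thesis using le[OF assms] le[OF assms(2,1), of "\<lambda>j i. f i j"] by (rule antisym)
qed

section \<open>Max-algebraic products and powers\<close>

lemma max_mult_vec_nth: "max_mult_vec A x $ i = max_sum (\<lambda>k. A $ i $ k * x $ k) UNIV"
  by (simp add: max_mult_vec_def)

lemma nonneg_max_mult_vec: "nonneg_vec (max_mult_vec A x)"
  by (simp add: nonneg_vec_def max_mult_vec_nth max_sum_nonneg)

lemma nonneg_max_mult: "nonneg_mat (max_mult A B)"
  by (simp add: nonneg_mat_def max_mult_def max_sum_nonneg)

lemma nonneg_column: "nonneg_mat A \<Longrightarrow> nonneg_vec (column j A)"
  by (simp add: nonneg_mat_def nonneg_vec_def column_def)

lemma nonneg_max_power: "nonneg_mat (max_power A k)"
  by (cases k) (auto simp: nonneg_max_mult, simp add: nonneg_mat_def mat_def)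

text \<open>Only nonnegative factors distribute over a maximum: the entries of \<open>x\<close> are
  moved into the maximum of the matrix product, and those of \<open>A\<close> out of the other one,
  after the two maxima are exchanged.\<close>

lemma max_mult_vec_assoc:
  assumes "nonneg_mat A" "nonneg_vec x"
  shows "max_mult_vec (max_mult A B) x = max_mult_vec A (max_mult_vec B x)"
proof (rule vec_eq_iff[THEN iffD2], rule allI)
  fix i
  have "max_mult_vec (max_mult A B) x $ i
      = max_sum (\<lambda>l. max_sum (\<lambda>k. x $ l * (A $ i $ k * B $ k $ l)) UNIV) UNIV"
    using assms(2) by (simp add: max_mult_vec_nth max_mult_def mult.commute[of _ "x $ _"]
        max_sum_mult_left nonneg_vec_def)
  also have "\<dots> = max_sum (\<lambda>k. max_sum (\<lambda>l. A $ i $ k * (B $ k $ l * x $ l)) UNIV) UNIV"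
    by (subst max_sum_swap) (simp_all add: mult_ac)
  also have "\<dots> = max_mult_vec A (max_mult_vec B x) $ i"
    using assms(1) by (simp add: max_mult_vec_nth max_sum_mult_left nonneg_mat_def)
  finally show "max_mult_vec (max_mult A B) x $ i = max_mult_vec A (max_mult_vec B x) $ i" .
qed

lemma column_max_mult: "column j (max_mult A B) = max_mult_vec A (column j B)"
  by (simp add: vec_eq_iff max_mult_def max_mult_vec_nth column_def)

text \<open>Reduces identities between matrices to the corresponding ones for matrix-vector
  products, column by column.\<close>

lemma mat_eq_columnI: "(\<And>j. column j A = column j B) \<Longrightarrow> A = B"
  by (simp add: vec_eq_iff column_def)

lemma max_mult_vec_mat_1: "nonneg_vec x \<Longrightarrow> max_mult_vec (mat 1) x = x"
  by (auto simp: vec_eq_iff max_mult_vec_nth mat_def nonneg_vec_def max_sum_le_iff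
      intro!: antisym max_sum_upper[THEN order_trans[rotated]])

lemma max_mult_assoc:
  assumes "nonneg_mat A" "nonneg_mat C"
  shows "max_mult (max_mult A B) C = max_mult A (max_mult B C)"
  using assms
  by (intro mat_eq_columnI) (simp add: column_max_mult max_mult_vec_assoc nonneg_column)

lemma max_mult_mat_1: "nonneg_mat B \<Longrightarrow> max_mult (mat 1) B = B"
  by (intro mat_eq_columnI) (simp add: column_max_mult max_mult_vec_mat_1 nonneg_column)

lemma max_power_add:
  assumes "nonneg_mat A"
  shows "max_power A (m + n) = max_mult (max_power A m) (max_power A n)"
  by (induction m) (simp_all add: assms max_mult_mat_1 max_mult_assoc nonneg_max_power)

lemma max_power_mult:
  assumes "nonneg_mat A"
  shows "max_power (max_power A m) k = max_power A (k * m)"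
  by (induction k) (simp_all add: assms max_power_add)

lemma max_mult_ge: "A $ i $ k * B $ k $ j \<le> max_mult A B $ i $ j"
  unfolding max_mult_def by (simp add: max_sum_upper[where f = "\<lambda>k. A $ i $ k * B $ k $ j"])

text \<open>In terms of walks: running \<open>m\<close> times through a closed walk with
  \<open>k\<close> arcs at \<open>i\<close> gives a closed walk with \<open>m * k\<close>
  arcs.\<close>

lemma max_power_diag_power_le:
  assumes "nonneg_mat A"
  shows "(max_power A k $ i $ i) ^ m \<le> max_power A (m * k) $ i $ i"
proof (induction m)
  case (Suc m)
  have "(max_power A k $ i $ i) ^ Suc m \<le> max_power A k $ i $ i * max_power A (m * k) $ i $ i"
    using Suc nonneg_max_power[of A k] by (simp add: mult_left_mono nonneg_mat_def)
  also have "\<dots> \<le> max_power A (Suc m * k) $ i $ i"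
    by (simp add: max_power_add[OF assms] max_mult_ge)
  finally show ?case .
qed (simp add: mat_def)

text \<open>Turns the span into the image of the nonnegative cone, so that products of matrices can
  be compared by their action on vectors.\<close>

lemma column_span_eq: "column_span A = {max_mult_vec A \<alpha> | \<alpha>. nonneg_vec \<alpha>}"
  by (simp add: column_span_def max_mult_vec_def column_def mult.commute)

section \<open>Cycles in finite digraphs\<close>

lemma (in fin_digraph) finite_cycles: "finite {p. cycle p}"
proof (rule finite_subset)
  show "{p. cycle p} \<subseteq> {p. set p \<subseteq> arcs G \<and> distinct p}"
    by (auto simp: cycle_conv awalk_def)
qed (simp add: finite_subset_distinct)

text \<open>Pigeonhole: walks can be prolonged forever, and one with as many arcs as there are nodes
  visits one node more than that, so it contains a nonempty closed walk.\<close>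

lemma (in fin_digraph) cycle_if_all_out_arcs:
  assumes "verts G \<noteq> {}" "\<And>v. v \<in> verts G \<Longrightarrow> \<exists>e\<in>arcs G. tail G e = v"
  shows "\<exists>p. cycle p"
proof -
  have "\<exists>u p v. awalk u p v \<and> length p = n" for n
  proof (induction n)
    case 0
    then show ?case using assms(1) awalk_Nil_iff by fastforce
  next
    case (Suc n)
    then obtain u p v where p: "awalk u p v" "length p = n" by auto
    then obtain e where "e \<in> arcs G" "tail G e = v" using assms(2) awalk_last_in_verts by blast
    then have "awalk u (p @ [e]) (head G e)"
      using p by (metis awalk_appendI arc_implies_awalk)
    then show ?case using p(2) by (intro exI[of _ u] exI[of _ "p @ [e]"] exI[of _ "head G e"]) simp
  qed
  then obtain u p v where p: "awalk u p v" "length p = card (verts G)" by blast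
  have "\<not> distinct (awalk_verts u p)"
  proof
    assume "distinct (awalk_verts u p)"
    then have "Suc (length p) = card (set (awalk_verts u p))"
      by (simp add: distinct_card length_awalk_verts)
    also have "\<dots> \<le> card (verts G)"
      using p(1) by (intro card_mono) auto
    finally show False using p(2) by simp
  qed
  then obtain w r where "awalk w r w" "r \<noteq> []"
    using awalk_not_distinct_decomp[OF p(1)] by auto
  then show ?thesis by (intro closed_w_imp_cycle[of r]) (auto simp: closed_w_def)
qed

section \<open>Walk weights and cycle means\<close>

lemma fin_digraph_matrix_digraph: "fin_digraph (matrix_digraph A)"
  by unfold_locales (auto simp: matrix_digraph_def)

lemma walk_weight_Nil [simp]: "walk_weight A [] = 1"
  and walk_weight_Cons [simp]: "walk_weight A (e # p) = A $ fst e $ snd e * walk_weight A p"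
  by (simp_all add: walk_weight_def split_beta)

text \<open>Each walk from \<open>u\<close> to \<open>v\<close> contributes one of the products
  whose maximum is the entry of the power; the first arc is split off in the induction.\<close>

lemma walk_weight_le_max_power:
  assumes "nonneg_mat A" "pre_digraph.cas (matrix_digraph A) u p v"
  shows "walk_weight A p \<le> max_power A (length p) $ u $ v"
  using assms(2)
proof (induction p arbitrary: u)
  case Nil
  then show ?case by (simp add: pre_digraph.cas.simps mat_def)
next
  case (Cons e p)
  then have e: "fst e = u" "pre_digraph.cas (matrix_digraph A) (snd e) p v"
    by (simp_all add: pre_digraph.cas.simps matrix_digraph_def)
  have "walk_weight A (e # p) \<le> A $ u $ snd e * max_power A (length p) $ snd e $ v"
    using Cons.IH[OF e(2)] assms(1) e(1) by (simp add: mult_left_mono nonneg_mat_def)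
  also have "\<dots> \<le> max_power A (length (e # p)) $ u $ v"
    by (simp add: max_mult_ge)
  finally show ?case .
qed

lemma walk_weight_pos:
  assumes "nonneg_mat A" "set p \<subseteq> arcs (matrix_digraph A)"
  shows "0 < walk_weight A p"
  using assms(2)
proof (induction p)
  case (Cons e p)
  then have "A $ fst e $ snd e \<noteq> 0" "0 < walk_weight A p"
    by (auto simp: matrix_digraph_def split_beta)
  then show ?case using assms(1) by (simp add: nonneg_mat_def less_le)
qed simp

lemma geometric_mean_le_max_cycle_mean:
  assumes "pre_digraph.cycle (matrix_digraph A) p"
  shows "geometric_mean A p \<le> max_cycle_mean A"
  unfolding max_cycle_mean_def using assms
  by (intro max_sum_upper) (auto intro: fin_digraph.finite_cycles fin_digraph_matrix_digraph)

lemma max_cycle_mean_attained: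
  assumes "max_cycle_mean A \<noteq> 0"
  obtains p where "critical_cycle A p"
proof -
  have "finite {p. pre_digraph.cycle (matrix_digraph A) p}"
    by (intro fin_digraph.finite_cycles fin_digraph_matrix_digraph)
  from max_sum_in[OF this] assms obtain p
    where "pre_digraph.cycle (matrix_digraph A) p" "max_cycle_mean A = geometric_mean A p"
    unfolding max_cycle_mean_def by blast
  then show thesis using that by (simp add: critical_cycle_def)
qed

lemma max_cycle_mean_ge_1:
  assumes "nonneg_mat B" "nonneg_vec x" "x \<noteq> 0" "max_mult_vec B x = x"
  shows "1 \<le> max_cycle_mean B"
proof -
  \<comment> \<open>Every node in the support of \<open>x\<close> has an arc on which the maximum in \<open>B x = x\<close> is attained;
    along these arcs the weights telescope.\<close>
  define G where "G = \<lparr>verts = {i. 0 < x $ i},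
    arcs = {(i, j). 0 < x $ i \<and> 0 < x $ j \<and> B $ i $ j * x $ j = x $ i}, tail = fst, head = snd\<rparr>"
  have Gs: "(i, j) \<in> arcs G \<Longrightarrow> B $ i $ j * x $ j = x $ i" "tail G = fst" "head G = snd" for i j
    by (simp_all add: G_def)
  interpret G: fin_digraph G
    by unfold_locales (auto simp: G_def)
  interpret M: fin_digraph "matrix_digraph B"
    by (rule fin_digraph_matrix_digraph)
  have "\<exists>e\<in>arcs G. tail G e = i" if "i \<in> verts G" for i
  proof -
    have i: "0 < x $ i" using that by (simp add: G_def)
    have eq: "max_sum (\<lambda>k. B $ i $ k * x $ k) UNIV = x $ i"
      using assms(4) by (metis max_mult_vec_nth)
    obtain j where j: "B $ i $ j * x $ j = x $ i"
      using max_sum_in[of UNIV "\<lambda>k. B $ i $ k * x $ k"] eq i by (metis finite less_irrefl)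
    moreover have "0 < x $ j"
      using j i assms(2) by (metis less_le mult_zero_right nonneg_vec_def)
    ultimately show ?thesis using i by (force simp: G_def)
  qed
  moreover obtain i where "x $ i \<noteq> 0"
    using assms(3) by (auto simp: vec_eq_iff)
  then have "verts G \<noteq> {}"
    using assms(2) by (auto simp: G_def nonneg_vec_def less_le)
  ultimately obtain p where p: "G.cycle p"
    using G.cycle_if_all_out_arcs by blast
  have telescope: "walk_weight B p * x $ v = x $ u" if "G.awalk u p v" for u p v
    using that
  proof (induction p arbitrary: u)
    case Nil
    then show ?case by (simp add: G.awalk_Nil_iff)
  next
    case (Cons e p)
    then have "walk_weight B p * x $ v = x $ snd e" "B $ u $ snd e * x $ snd e = x $ u" "fst e = u"
      using Gs by (auto simp: G.awalk_Cons_iff)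
    then show ?case by (simp add: mult.assoc)
  qed
  obtain u where u: "G.awalk u p u" using p by (auto simp: G.cycle_def)
  then have "u \<in> verts G" by (rule G.awalk_hd_in_verts)
  then have "0 < x $ u" by (simp add: G_def)
  then have "walk_weight B p = 1" using telescope[OF u] by simp
  then have "geometric_mean B p = 1" by (simp add: geometric_mean_def)
  \<comment> \<open>An arc of \<open>G\<close> satisfies \<open>B $ i $ j * x $ j = x $ i\<close>
    with \<open>x $ i\<close> positive, so its weight in \<open>B\<close> is nonzero.\<close>
  moreover have "subgraph G (matrix_digraph B)"
    using G.wf_digraph_axioms M.wf_digraph_axioms
    by (auto simp: subgraph_def compatible_def G_def matrix_digraph_def)
  then have "M.cycle p" using p by (rule M.subgraph_cycle)
  ultimately show ?thesis using geometric_mean_le_max_cycle_mean by metis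
qed

text \<open>Let a be the diagonal entry at \<open>u\<close> of the power of \<open>B\<close> given
  by the cycle length. A stable power has a positive diagonal entry b at \<open>u\<close>, and
  stability gives a * b \<le> b. Hence a \<le> 1, and a bounds the weight of the cycle.\<close>

lemma max_cycle_mean_le_1:
  assumes "nonneg_mat B" and stable: "\<And>s. t \<le> s \<Longrightarrow> max_power B (Suc s) = max_power B s"
  shows "max_cycle_mean B \<le> 1"
proof -
  interpret M: fin_digraph "matrix_digraph B"
    by (rule fin_digraph_matrix_digraph)
  have "geometric_mean B p \<le> 1" if p: "M.cycle p" for p
  proof -
    obtain u where u: "M.awalk u p u" and ne: "p \<noteq> []" using p by (auto simp: M.cycle_def)
    let ?k = "length p"
    have w: "0 < walk_weight B p" "walk_weight B p \<le> max_power B ?k $ u $ u"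
      using u assms(1) walk_weight_pos walk_weight_le_max_power by (auto simp: M.awalk_def)
    \<comment> \<open>The cycle is repeated \<open>t\<close> times because the exponent
      \<open>t * ?k\<close> is then at least \<open>t\<close>, where the powers are stable.\<close>
    have "0 < (max_power B ?k $ u $ u) ^ t" using w by simp
    also have "\<dots> \<le> max_power B (t * ?k) $ u $ u"
      by (rule max_power_diag_power_le[OF assms(1)])
    finally have pos: "0 < max_power B (t * ?k) $ u $ u" .
    have "t * 1 \<le> t * ?k"
      using ne by (intro mult_le_mono2) (simp add: Suc_le_eq)
    then have "max_power B (m + t * ?k) = max_power B (t * ?k)" for m
      by (induction m) (simp_all add: stable[simplified])
    then have "max_power B ?k $ u $ u * max_power B (t * ?k) $ u $ u \<le> max_power B (t * ?k) $ u $ u"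
      using max_mult_ge[of "max_power B ?k" u u "max_power B (t * ?k)" u]
      by (simp flip: max_power_add[OF assms(1)])
    then have "walk_weight B p \<le> 1" using pos w(2) by simp
    then show ?thesis using w(1) by (simp add: geometric_mean_def powr_le1)
  qed
  then show ?thesis
    by (simp add: max_cycle_mean_def max_sum_le_iff[OF M.finite_cycles])
qed

section \<open>Positivity of the cyclicity\<close>

lemma fin_digraph_critical_graph: "fin_digraph (critical_graph A)"
  by unfold_locales (simp_all add: critical_graph_def del: split_paired_Ex, blast+)

text \<open>The gcd is 0 only if the component has no cycle. A node of it is an end of an arc
  \<open>e\<close> of a critical cycle; the rest of that cycle leads back, so both ends of
  \<open>e\<close> lie in the component, where \<open>e\<close> can be closed up.\<close>

lemma component_cyclicity_pos:
  assumes "H \<in> pre_digraph.sccs (critical_graph A)"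
  shows "0 < component_cyclicity H"
proof -
  interpret M: fin_digraph "matrix_digraph A"
    by (rule fin_digraph_matrix_digraph)
  interpret C: fin_digraph "critical_graph A"
    by (rule fin_digraph_critical_graph)
  have H: "induced_subgraph H (critical_graph A)" "strongly_connected H"
    using assms by auto
  interpret H: wf_digraph H
    using H(1) by (auto simp: induced_subgraph_def subgraph_def)
  obtain v where v: "v \<in> verts H" using H(2) by (auto simp: strongly_connected_def)
  then have "v \<in> verts (critical_graph A)"
    using H(1) by (auto simp: induced_subgraph_def subgraph_def)
  then obtain p e where p: "critical_cycle A p" "e \<in> set p" and ve: "v = fst e \<or> v = snd e"
    by (auto simp: critical_graph_def)
  obtain u where u: "M.awalk u p u" using p(1) by (auto simp: critical_cycle_def M.cycle_def)
  obtain q r where qr: "p = q @ e # r" using p(2) by (meson split_list)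
  have "C.awalk u p u"
  proof -
    \<comment> \<open>Whether arcs are consecutive depends only on the tail and head maps, which
      both digraphs share.\<close>
    have "pre_digraph.cas (critical_graph A) = M.cas"
      by (rule compatible_cas) (simp add: compatible_def critical_graph_def matrix_digraph_def)
    then have "C.cas u p u" using u by (simp add: M.awalk_def)
    moreover have "set p \<subseteq> arcs (critical_graph A)"
      using p(1) by (auto simp: critical_graph_def)
    moreover have "u \<in> verts (critical_graph A)"
      using calculation(1,2) p(2) C.wellformed(1)[of "hd p"] by (cases p) auto
    ultimately show ?thesis by (simp add: C.awalk_def)
  qed
  have tail_head: "tail (critical_graph A) e = fst e" "head (critical_graph A) e = snd e"
    by (simp_all add: critical_graph_def)
  have walks: "C.awalk u q (fst e)" "e \<in> arcs (critical_graph A)" "C.awalk (snd e) r u"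
    using \<open>C.awalk u p u\<close> by (auto simp: qr C.awalk_Cons_iff tail_head)
  \<comment> \<open>One direction is the arc \<open>e\<close> itself, the other runs through
    \<open>r\<close> and then \<open>q\<close>.\<close>
  have mutual: "fst e \<rightarrow>\<^sup>*\<^bsub>critical_graph A\<^esub> snd e" "snd e \<rightarrow>\<^sup>*\<^bsub>critical_graph A\<^esub> fst e"
    using C.arc_implies_awalk[OF walks(2)] C.awalk_appendI[OF walks(3,1)] tail_head
    unfolding C.reachable_awalk by metis+
  have "verts H \<in> C.sccs_verts"
    using assms by (simp add: C.sccs_verts_conv)
  then have ends: "fst e \<in> verts H" "snd e \<in> verts H"
    using mutual v ve unfolding C.in_sccs_verts_conv_reachable by metis+
  have e: "e \<in> arcs H" "tail H e = fst e" "head H e = snd e"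
  proof -
    have "arcs H = {e \<in> arcs (critical_graph A). tail (critical_graph A) e \<in> verts H
        \<and> head (critical_graph A) e \<in> verts H}"
      and "tail (critical_graph A) = tail H" "head (critical_graph A) = head H"
      using H(1) unfolding induced_subgraph_def subgraph_def compatible_def by blast+
    then show "tail H e = fst e" "head H e = snd e" "e \<in> arcs H"
      using ends walks(2) tail_head by (metis, metis, metis (no_types, lifting) mem_Collect_eq)
  qed
  have "snd e \<rightarrow>\<^sup>*\<^bsub>H\<^esub> fst e" using H(2) ends by (auto simp: strongly_connected_def)
  then obtain s where "H.awalk (snd e) s (fst e)" by (auto simp: H.reachable_awalk)
  then have "H.closed_w (e # s)"
    using e ends by (auto simp: H.closed_w_def H.awalk_Cons_iff)
  then obtain c where "H.cycle c" using H.closed_w_imp_cycle by blast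
  then have "component_cyclicity H dvd length c" "c \<noteq> []"
    by (auto simp: component_cyclicity_def H.cycle_def)
  then show ?thesis by (metis dvd_0_left gr0I length_0_conv)
qed

text \<open>Finiteness of the set of components matters: the lcm of an infinite set of naturals is
  0.\<close>

lemma cyclicity_critical_graph_pos: "0 < cyclicity (critical_graph A)"
proof -
  interpret C: fin_digraph "critical_graph A"
    by (rule fin_digraph_critical_graph)
  have "C.sccs_verts \<subseteq> Pow (verts (critical_graph A))"
    by (auto simp: C.sccs_verts_conv dest!: C.in_sccs_imp_induced
        simp: induced_subgraph_def subgraph_def)
  then have "finite C.sccs_verts" by (rule finite_subset) simp
  then have "finite C.sccs" by (simp add: C.sccs_conv_sccs_verts)
  moreover have "0 \<notin> component_cyclicity ` C.sccs"
    using component_cyclicity_pos[of _ A] by (metis imageE less_irrefl)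
  ultimately have "cyclicity (critical_graph A) \<noteq> 0"
    by (simp add: cyclicity_def Lcm_0_iff)
  then show ?thesis by simp
qed

theorem proposition4p7:
  fixes A :: "real ^ 'n ^ 'n" and T :: int and \<gamma> :: nat
  assumes "nonneg_mat A"
    and "irreducible_mat A"
    and "definite_mat A"
    and "\<gamma> = cyclicity (critical_graph A)"
    and "is_transient A T"
  shows "\<forall>r::nat. T \<le> int r \<longrightarrow> column_span (max_power A r) = eigencone (max_power A \<gamma>)"
proof (intro allI impI)
  fix r :: nat
  assume r: "T \<le> int r"
  let ?B = "max_power A \<gamma>"
  have pos: "0 < \<gamma>" using assms(4) cyclicity_critical_graph_pos by simp
  have period: "max_mult ?B (max_power A s) = max_power A s" if "T \<le> int s" for s
    using that assms(1,4,5)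
    by (simp add: is_transient_def Let_def add.commute flip: max_power_add)
  have B_fixes: "max_mult_vec ?B (max_mult_vec (max_power A s) x) = max_mult_vec (max_power A s) x"
    if "T \<le> int s" "nonneg_vec x" for s x
    using that by (simp add: period nonneg_max_power flip: max_mult_vec_assoc)

  have "max_cycle_mean ?B = 1"
  proof (rule antisym)
    show "max_cycle_mean ?B \<le> 1"
    proof (rule max_cycle_mean_le_1[where t = "nat T"])
      \<comment> \<open>The powers of \<open>?B\<close> with exponent \<open>s\<close> are those of
        \<open>A\<close> with exponent \<open>s * \<gamma>\<close>, which is at least
        \<open>s\<close> and so beyond the transient.\<close>
      fix s assume "nat T \<le> s"
      moreover have "s * 1 \<le> s * \<gamma>" using pos by (intro mult_le_mono2) simp
      ultimately have "T \<le> int (s * \<gamma>)" by linarith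
      then show "max_power ?B (Suc s) = max_power ?B s"
        by (simp add: max_power_mult assms(1) period)
    qed (rule nonneg_max_power)
    \<comment> \<open>A nonzero vector fixed by \<open>?B\<close> is wanted. Going
      \<open>nat T\<close> times round a cycle of \<open>A\<close> through \<open>u\<close> gives a
      power beyond the transient with positive diagonal entry at \<open>u\<close>; its column
      \<open>u\<close> serves.\<close>
    obtain p where p: "pre_digraph.cycle (matrix_digraph A) p"
      using max_cycle_mean_attained[of A] assms(3) by (auto simp: definite_mat_def critical_cycle_def)
    then obtain u where u: "pre_digraph.awalk (matrix_digraph A) u p u" "p \<noteq> []"
      by (auto simp: pre_digraph.cycle_def)
    let ?m = "nat T * length p"
    have "0 < max_power A (length p) $ u $ u"
      using u(1) assms(1) walk_weight_pos[of A p] walk_weight_le_max_power[of A u p u]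
      by (auto simp: pre_digraph.awalk_def)
    then have "0 < max_power A ?m $ u $ u"
      using max_power_diag_power_le[OF assms(1)] by (metis less_le_trans zero_less_power)
    then have "column u (max_power A ?m) \<noteq> 0"
      by (auto simp: vec_eq_iff column_def intro: exI[of _ u])
    moreover have "nat T * 1 \<le> ?m" using u(2) by (intro mult_le_mono2) (simp add: Suc_le_eq)
    then have "T \<le> int ?m" by linarith
    then have "max_mult_vec ?B (column u (max_power A ?m)) = column u (max_power A ?m)"
      by (metis column_max_mult period)
    ultimately show "1 \<le> max_cycle_mean ?B"
      by (intro max_cycle_mean_ge_1) (auto simp: nonneg_max_power nonneg_column)
  qed
  then have eigen: "eigencone ?B = {x. nonneg_vec x \<and> max_mult_vec ?B x = x}"
    by (simp add: eigencone_def)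

  show "column_span (max_power A r) = eigencone ?B"
  proof (intro equalityI subsetI)
    fix x assume "x \<in> column_span (max_power A r)"
    then show "x \<in> eigencone ?B"
      using B_fixes[OF r] by (auto simp: eigen column_span_eq nonneg_max_mult_vec)
  next
    fix x assume "x \<in> eigencone ?B"
    then have x: "nonneg_vec x" "max_mult_vec ?B x = x" by (auto simp: eigen)
    have "max_mult_vec (max_power ?B k) x = x" for k
      by (induction k) (simp_all add: x max_mult_vec_mat_1 max_mult_vec_assoc nonneg_max_power)
    then have "x = max_mult_vec (max_power A (r * \<gamma>)) x"
      by (simp add: max_power_mult assms(1))
    \<comment> \<open>The subtraction of naturals is exact because \<gamma> is at least 1.\<close>
    also have "r * \<gamma> = r + (r * \<gamma> - r)" using pos by simp
    also have "max_mult_vec (max_power A \<dots>) x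
        = max_mult_vec (max_power A r) (max_mult_vec (max_power A (r * \<gamma> - r)) x)"
      by (simp only: max_power_add assms(1) max_mult_vec_assoc nonneg_max_power x(1))
    finally show "x \<in> column_span (max_power A r)"
      unfolding column_span_eq using nonneg_max_mult_vec by blast
  qed
qed

end
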